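(* Let $n\in\mathbb{N}$ and $\mathbf{y}=(y_1,y_2,\ldots,y_n)\in\mathbb{N}^n$. Then $\mathbf{y}$ is minimally invariant if and only if there does not exist an integer $w>1$ such that $(1^{n-1},w)\in\mathsf{PA}^{\mathrm{inv}}_n(\mathbf{y})$.
   Context: $\mathbb{N}=\{1,2,3,\ldots\}$ and $[k]=\{1,\ldots,k\}$. Let $\mathbf{y}=(y_1,\ldots,y_n)\in\mathbb{N}^n$ be car lengths and $m=\sum_{i=1}^n y_i$. A one-way street has spots $1,\ldots,m$, initially empty. Given preferences $\mathbf{x}=(x_1,\ldots,x_n)\in[m]^n$, cars $1,\ldots,n$ enter in this order; car $i$ parks in spots $j,j+1,\ldots,j+y_i-1$, where $j\ge x_i$ is the smallest integer such that $j+y_i-1\le m$ and all these spots are unoccupied; if no such $j$ exists, parking fails. If all cars park, $\mathbf{x}$ is a parking assortment for $\mathbf{y}$; $\mathsf{PA}_n(\mathbf{y})$ is the set of these. $\mathsf{PA}^{\mathrm{inv}}_n(\mathbf{y})$ is the set of (permutation) invariant parking assortments: those $\mathbf{x}\in\mathsf{PA}_n(\mathbf{y})$ all of whose rearrangements are also in $\mathsf{PA}_n(\mathbf{y})$ (with $\mathbf{y}$ fixed). $(1^{n-1},w)$ denotes the list of $n-1$ ones followed by $w$, and $(1^n)$ the list of $n$ ones. $\mathbf{y}$ is called minimally invariant if $\mathsf{PA}^{\mathrm{inv}}_n(\mathbf{y})=\{(1^n)\}$. *)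

theory Defs
  imports "HOL-Library.Multiset"
begin

text \<open>Lists are 0-indexed in HOL, while the spots on the street are numbered \<open>1, \<dots>, m\<close>.
  The car lengths \<open>y\<close> are meant to be positive, and preferences are required to lie in
  \<open>{1..m}\<close>, so the natural-number subtraction \<open>j + l - 1\<close> below never truncates.\<close>

definition fits :: "nat \<Rightarrow> nat set \<Rightarrow> nat \<Rightarrow> nat \<Rightarrow> nat \<Rightarrow> bool" where
  "fits m occ a l j \<longleftrightarrow> a \<le> j \<and> j + l - 1 \<le> m \<and> {j..j + l - 1} \<inter> occ = {}"

text \<open>\<open>all_park m occ xs ys\<close>: on a street with spots \<open>1, \<dots>, m\<close>, of which those in \<open>occ\<close> are
  already taken, the remaining cars with preferences \<open>xs\<close> and lengths \<open>ys\<close>, entering in list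
  order, all manage to park.\<close>

fun all_park :: "nat \<Rightarrow> nat set \<Rightarrow> nat list \<Rightarrow> nat list \<Rightarrow> bool" where
  "all_park m occ [] [] \<longleftrightarrow> True"
| "all_park m occ (a # xs) (l # ys) \<longleftrightarrow>
     (\<exists>j. fits m occ a l j) \<and>
     (let j = (LEAST j. fits m occ a l j) in all_park m (occ \<union> {j..j + l - 1}) xs ys)"
| "all_park m occ _ _ \<longleftrightarrow> False"

definition parking_assortments :: "nat list \<Rightarrow> nat list set" where
  "parking_assortments y =
     {x. length x = length y \<and> set x \<subseteq> {1..sum_list y} \<and> all_park (sum_list y) {} x y}"

definition invariant_parking_assortments :: "nat list \<Rightarrow> nat list set" where
  "invariant_parking_assortments y =
     {x \<in> parking_assortments y. \<forall>x'. mset x' = mset x \<longrightarrow> x' \<in> parking_assortments y}"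

definition minimally_invariant :: "nat list \<Rightarrow> bool" where
  "minimally_invariant y \<longleftrightarrow> invariant_parking_assortments y = {replicate (length y) 1}"

end

theory Submission
  imports Defs
begin

text \<open>A preference list that is not all ones has a least entry \<open>w > 1\<close>, and this entry can be
  kept while all others are replaced by 1. In a rearrangement of \<open>(1\<^sup>n\<^sup>-\<^sup>1, w)\<close>, take the longest
  prefix that can be completed to a rearrangement of the given invariant list; it is completed by
  preferences \<open>\<ge> w\<close>. Since the cars exactly fill the street and the completing cars never use a spot
  below \<open>w\<close>, the prefix already fills \<open>1, \<dots>, w - 1\<close>. As its preferences are at most \<open>w\<close>, it
  leaves no hole beyond \<open>w\<close> either, so it occupies an initial segment of the street, after which
  all further cars with preferences at most \<open>w\<close> park contiguously.\<close>

section \<open>One parking step\<close>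

lemma all_park_Cons_cases:
  assumes "all_park m occ (a # xs) ys"
  obtains l ys' j where "ys = l # ys'" "fits m occ a l j" "\<And>i. fits m occ a l i \<Longrightarrow> j \<le> i"
    "j = (LEAST j. fits m occ a l j)" "all_park m (occ \<union> {j..j + l - 1}) xs ys'"
proof -
  obtain l ys' where ys: "ys = l # ys'"
    using assms by (cases ys) auto
  let ?j = "LEAST j. fits m occ a l j"
  have "\<exists>j. fits m occ a l j" "all_park m (occ \<union> {?j..?j + l - 1}) xs ys'"
    using assms ys by (auto simp: Let_def)
  then show thesis
    using that[OF ys, of ?j] by (blast intro: LeastI_ex Least_le)
qed

lemma all_park_ConsI:
  assumes "fits m occ a l j" "j = (LEAST j. fits m occ a l j)"
    "all_park m (occ \<union> {j..j + l - 1}) xs ys"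
  shows "all_park m occ (a # xs) (l # ys)"
  using assms by (auto simp: Let_def)

text \<open>Lets later inductions maintain that the occupied set lies on the street and that its
  size plus the remaining lengths equals \<open>m\<close>. The count is exact because a car only
  takes free spots.\<close>

lemma fits_occupied:
  assumes "fits m occ a l j" "occ \<subseteq> {1..m}" "1 \<le> a" "1 \<le> l"
  shows "occ \<union> {j..j + l - 1} \<subseteq> {1..m}" "card (occ \<union> {j..j + l - 1}) = card occ + l"
proof -
  have "finite occ"
    using assms(2) finite_subset by blast
  then show "card (occ \<union> {j..j + l - 1}) = card occ + l"
    using assms by (subst card_Un_disjoint) (auto simp: fits_def)
qed (use assms in \<open>auto simp: fits_def\<close>)

section \<open>Filling the street exactly\<close>

text \<open>A car preferring at most \<open>c + 1\<close> parks exactly at \<open>c + 1\<close>, so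
  the occupied set stays an initial segment, and the lengths add up to end at
  \<open>m\<close>.\<close>

lemma all_park_contiguous:
  assumes "length zs = length ys" "set zs \<subseteq> {1..c + 1}" "\<forall>l\<in>set ys. 1 \<le> l"
    "m = c + sum_list ys"
  shows "all_park m {1..c} zs ys"
  using assms
proof (induction zs ys arbitrary: c rule: list_induct2)
  case (Cons a zs l ys)
  have fits: "fits m {1..c} a l (c + 1)"
    using Cons.prems by (auto simp: fits_def)
  moreover have "c + 1 \<le> j" if "fits m {1..c} a l j" for j
  proof (rule ccontr)
    assume "\<not> c + 1 \<le> j"
    then have "j \<in> {j..j + l - 1} \<inter> {1..c}"
      using that Cons.prems by (auto simp: fits_def)
    then show False
      using that by (auto simp: fits_def)
  qed
  ultimately have least: "c + 1 = (LEAST j. fits m {1..c} a l j)"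
    by (metis (lifting) Least_equality)
  have eq: "{1..c} \<union> {c + 1..c + 1 + l - 1} = {1..c + l}"
    using Cons.prems by auto
  have "all_park m {1..c + l} zs ys"
    using Cons.prems by (intro Cons.IH) auto
  then show ?case
    using all_park_ConsI[OF fits least] eq by simp
qed simp

text \<open>The remaining lengths add up to the number of free spots, so some car must eventually
  cover \<open>p\<close>, and a car covers only spots from its preference on.\<close>

lemma all_park_free_spot:
  assumes "all_park m occ xs ys" "occ \<subseteq> {1..m}" "\<forall>a\<in>set xs. 1 \<le> a" "\<forall>l\<in>set ys. 1 \<le> l"
    "card occ + sum_list ys = m" "p \<in> {1..m} - occ"
  shows "\<exists>a\<in>set xs. a \<le> p"
  using assms
proof (induction xs arbitrary: occ ys)
  case Nil
  then have "ys = []"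
    by (cases ys) auto
  then have "occ = {1..m}"
    using Nil.prems by (intro card_subset_eq) auto
  then show ?case
    using Nil.prems by simp
next
  case (Cons a xs)
  obtain l ys' j where *: "ys = l # ys'" "fits m occ a l j"
      "all_park m (occ \<union> {j..j + l - 1}) xs ys'"
    using Cons.prems(1) by (elim all_park_Cons_cases)
  show ?case
  proof (cases "p \<in> {j..j + l - 1}")
    case True
    then show ?thesis
      using *(2) by (auto simp: fits_def)
  next
    case False
    have "\<exists>a\<in>set xs. a \<le> p"
      by (rule Cons.IH[OF *(3)]) (use fits_occupied[OF *(2)] *(1) Cons.prems False in auto)
    then show ?thesis
      by simp
  qed
qed

section \<open>Exchanging the last preferences\<close>

lemma down_closed_eq_atLeastAtMost:
  fixes A :: "nat set"
  assumes "finite A" "0 \<notin> A" "\<And>p q. p \<in> A \<Longrightarrow> 1 \<le> q \<Longrightarrow> q \<le> p \<Longrightarrow> q \<in> A"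
  shows "\<exists>c. A = {1..c}"
proof (cases "A = {}")
  case False
  have "A = {1..Max A}"
  proof (intro set_eqI iffI)
    fix q assume "q \<in> A"
    then show "q \<in> {1..Max A}"
      using assms(1,2) by (cases q) auto
  qed (use assms Max_in[OF assms(1) False] in auto)
  then show ?thesis ..
qed (auto intro: exI[of _ 0])

text \<open>Induction over the cars of \<open>us\<close>, which park the same way in both lists. The
  invariant \<open>closed\<close> says that every hole of \<open>occ\<close> beyond \<open>w\<close>
  has only free spots after it; holes below \<open>w\<close> may arise on the way, but parking with
  \<open>vs\<close> shows that they are filled once \<open>us\<close> is exhausted.\<close>

lemma all_park_replace_suffix:
  assumes "all_park m occ (us @ vs) ys" "length zs = length vs"
    "set us \<subseteq> {1..w}" "set vs \<subseteq> {w..}" "set zs \<subseteq> {1..w}" "1 \<le> w"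
    "occ \<subseteq> {1..m}" "\<forall>l\<in>set ys. 1 \<le> l" "card occ + sum_list ys = m"
    and closed: "\<And>p q. p \<in> occ \<Longrightarrow> w \<le> q \<Longrightarrow> q \<le> p \<Longrightarrow> q \<in> occ"
    and len: "length ys = length (us @ vs)"
  shows "all_park m occ (us @ zs) ys"
  using assms
proof (induction us arbitrary: occ ys)
  case Nil
  show ?case
  proof (cases "vs = []")
    case True
    then show ?thesis
      using Nil.prems by simp
  next
    case False
    \<comment> \<open>No preference in \<open>vs\<close> is below \<open>w\<close>, so a free spot
      there would stay empty forever.\<close>
    have low: "p \<in> occ" if "1 \<le> p" "p < w" "p \<le> m" for p
    proof (rule ccontr)
      assume "p \<notin> occ"
      then have "\<exists>a\<in>set vs. a \<le> p"
        using Nil.prems that by (intro all_park_free_spot[of m occ vs ys]) auto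
      then show False
        using Nil.prems(4) that by auto
    qed
    \<comment> \<open>The first car of \<open>vs\<close> parks at some \<open>j\<close> \<ge>
      \<open>w\<close> on the street. This makes \<open>low\<close> applicable to
      \<open>c + 1\<close> when \<open>c + 1 < w\<close>.\<close>
    have "w \<le> m"
    proof -
      obtain v vs' where v: "vs = v # vs'"
        using False by (cases vs) auto
      obtain l ys' j where "ys = l # ys'" "fits m occ v l j"
        using Nil.prems(1) unfolding v append_Nil by (elim all_park_Cons_cases)
      then show ?thesis
        using Nil.prems(4,8) v by (auto simp: fits_def)
    qed
    have "finite occ"
      using Nil.prems(7) finite_subset by blast
    moreover have "q \<in> occ" if "p \<in> occ" "1 \<le> q" "q \<le> p" for p q
      using low[of q] Nil.prems(7) Nil.prems(10)[OF that(1) _ that(3)] that by force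
    moreover have "0 \<notin> occ"
      using Nil.prems(7) by auto
    ultimately obtain c where c: "occ = {1..c}"
      using down_closed_eq_atLeastAtMost[of occ] by metis
    have "w \<le> c + 1"
    proof (rule ccontr)
      assume "\<not> w \<le> c + 1"
      then have "c + 1 \<in> occ"
        using \<open>w \<le> m\<close> by (intro low) auto
      then show False
        using c by simp
    qed
    then have "set zs \<subseteq> {1..c + 1}"
      using Nil.prems(5) by auto
    then show ?thesis
      using Nil.prems unfolding c append_Nil by (intro all_park_contiguous) auto
  qed
next
  case (Cons a us)
  obtain l ys' j where *: "ys = l # ys'" "fits m occ a l j"
      "\<And>i. fits m occ a l i \<Longrightarrow> j \<le> i" "j = (LEAST j. fits m occ a l j)"
      "all_park m (occ \<union> {j..j + l - 1}) (us @ vs) ys'"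
    using Cons.prems(1) unfolding append_Cons by (rule all_park_Cons_cases) (rule that)
  \<comment> \<open>The invariant survives: a new hole \<open>q\<close> would lie before
    \<open>j\<close>, with nothing of \<open>occ\<close> at or after it. As \<open>a\<close> \<le>
    \<open>w\<close> \<le> \<open>q\<close>, the car would already fit at \<open>q\<close>, against
    the minimality of \<open>j\<close>.\<close>
  have "q \<in> occ \<union> {j..j + l - 1}"
    if p: "p \<in> occ \<union> {j..j + l - 1}" and q: "w \<le> q" "q \<le> p" for p q
  proof (rule ccontr)
    assume neg: "q \<notin> occ \<union> {j..j + l - 1}"
    with p q Cons.prems(10) have "q < j"
      by auto
    moreover have "r \<notin> occ" if "q \<le> r" for r
      using neg Cons.prems(10) that q by blast
    ultimately have "fits m occ a l q"
      using *(2) q Cons.prems(3) by (auto simp: fits_def)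
    then show False
      using *(3) \<open>q < j\<close> by fastforce
  qed
  then have "all_park m (occ \<union> {j..j + l - 1}) (us @ zs) ys'"
    by (intro Cons.IH[OF *(5)]) (use fits_occupied[OF *(2)] *(1) Cons.prems in auto)
  then show ?case
    using *(1,2,4) by (auto intro: all_park_ConsI simp del: all_park.simps)
qed

lemma parking_assortments_replace_suffix:
  assumes "us @ vs \<in> parking_assortments y" "\<forall>l\<in>set y. 1 \<le> l" "length zs = length vs"
    "set us \<subseteq> {1..w}" "set vs \<subseteq> {w..}" "set zs \<subseteq> {1..w}" "1 \<le> w" "w \<le> sum_list y"
  shows "us @ zs \<in> parking_assortments y"
proof -
  have "all_park (sum_list y) {} (us @ zs) y"
    by (rule all_park_replace_suffix[where vs = vs and w = w])
      (use assms in \<open>auto simp: parking_assortments_def\<close>)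
  then show ?thesis
    using assms by (fastforce simp: parking_assortments_def)
qed

section \<open>Rearrangements with at most one entry other than 1\<close>

lemma mset_eq_replicate_mset_imp:
  assumes "mset xs = replicate_mset k a"
  shows "xs = replicate k a"
proof (rule replicate_eqI)
  show "length xs = k"
    using arg_cong[OF assms, of size] by simp
  show "b = a" if "b \<in> set xs" for b
    using that arg_cong[OF assms, of set_mset] by (auto split: if_splits)
qed

lemma replicate_1_invariant:
  assumes "y \<noteq> []" "\<forall>l\<in>set y. 1 \<le> l"
  shows "replicate (length y) 1 \<in> invariant_parking_assortments y"
proof -
  have "1 \<le> sum_list y"
    using assms by (cases y) auto
  \<comment> \<open>The empty street is the initial segment with \<open>c = 0\<close>.\<close>
  moreover have "all_park (sum_list y) {1..0} (replicate (length y) 1) y"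
    using assms by (intro all_park_contiguous) auto
  ultimately have "replicate (length y) 1 \<in> parking_assortments y"
    by (auto simp: parking_assortments_def)
  moreover have "x' = replicate (length y) 1"
    if "mset x' = mset (replicate (length y) (1::nat))" for x'
    using that mset_eq_replicate_mset_imp by simp
  ultimately show ?thesis
    by (auto simp: invariant_parking_assortments_def)
qed

lemma mset_eq_replicate_snocE:
  assumes "mset z = mset (replicate k a @ [b])"
  obtains i j where "z = replicate i a @ b # replicate j a" "i + j = k"
proof -
  have "b \<in> set z"
    using assms by (metis in_set_conv_decomp mset_eq_setD)
  then obtain us vs where z: "z = us @ b # vs"
    by (meson split_list)
  then have "mset (us @ vs) = replicate_mset k a"
    using assms by simp
  then have *: "us @ vs = replicate k a"
    by (rule mset_eq_replicate_mset_imp)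
  have "set (us @ vs) \<subseteq> {a}"
    unfolding * by auto
  then have "us = replicate (length us) a" "vs = replicate (length vs) a"
    by (auto intro!: replicate_eqI)
  moreover have "length us + length vs = k"
    using arg_cong[OF *, of length] by simp
  ultimately show thesis
    using that z by metis
qed

lemma replace_by_1_invariant:
  assumes x: "x \<in> invariant_parking_assortments y" and pos: "\<forall>l\<in>set y. 1 \<le> l"
    and ne: "x \<noteq> replicate (length y) 1"
  shows "\<exists>w>1. replicate (length y - 1) 1 @ [w] \<in> invariant_parking_assortments y"
proof -
  have len: "length x = length y" and rng: "set x \<subseteq> {1..sum_list y}"
    and inv: "\<And>x'. mset x' = mset x \<Longrightarrow> x' \<in> parking_assortments y"
    using x by (auto simp: invariant_parking_assortments_def parking_assortments_def)
  \<comment> \<open>Up to order, \<open>x\<close> consists of \<open>k\<close> ones, one copy of its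
    least entry \<open>w\<close> above 1, and \<open>rest\<close>, whose entries are at least
    \<open>w\<close>.\<close>
  define big where "big = filter (\<lambda>a. a \<noteq> 1) x"
  define w where "w = Min (set big)"
  define rest where "rest = remove1 w big"
  define k where "k = count (mset x) 1"
  have "big \<noteq> []"
    using ne len by (auto simp: big_def filter_empty_conv intro: replicate_eqI)
  then have w: "w \<in> set big"
    by (simp add: w_def)
  then have "w \<in> set x" "w \<noteq> 1"
    by (auto simp: big_def)
  then have w1: "1 < w" "w \<le> sum_list y"
    using rng by force+
  have rest: "set rest \<subseteq> {w..}"
    using set_remove1_subset[of w big] by (auto simp: rest_def w_def)
  have "mset x = filter_mset (\<lambda>a. a = 1) (mset x) + mset big"
    unfolding big_def mset_filter by (rule multiset_partition)
  then have mset_x: "mset x = replicate_mset k 1 + add_mset w (mset rest)"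
    using w by (simp add: rest_def k_def filter_eq_replicate_mset)
  have "length y = size (mset x)"
    using len by simp
  also have "\<dots> = k + 1 + length rest"
    unfolding mset_x by simp
  finally have len_y: "length y = k + 1 + length rest" .
  have park: "z \<in> parking_assortments y"
    if mz: "mset z = mset (replicate (length y - 1) 1 @ [w])" for z
  proof -
    obtain i j where z: "z = replicate i 1 @ w # replicate j 1" and ij: "i + j = length y - 1"
      using mset_eq_replicate_snocE[OF mz] .
    show ?thesis
    proof (cases "i \<le> k")
      case True
      \<comment> \<open>\<open>x\<close> has enough ones to reach \<open>w\<close> in
        \<open>z\<close>; the prefix uses up all its ones and \<open>w\<close>, and only
        \<open>rest\<close> is replaced by ones.\<close>
      let ?us = "replicate i 1 @ w # replicate (k - i) 1"
      have "?us @ rest \<in> parking_assortments y"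
        using True by (intro inv) (simp add: mset_x multiset_eq_iff)
      then have "?us @ replicate (length rest) 1 \<in> parking_assortments y"
        by (rule parking_assortments_replace_suffix[where w = w]) (use pos rest w1 in auto)
      also have "?us @ replicate (length rest) 1 = z"
        using True ij len_y z by (simp flip: replicate_add)
      finally show ?thesis .
    next
      case False
      \<comment> \<open>The ones of \<open>x\<close> run out before \<open>w\<close> is reached in
        \<open>z\<close>, so \<open>w\<close> belongs to the replaced suffix and reappears later in
        the new one.\<close>
      have "replicate k 1 @ w # rest \<in> parking_assortments y"
        by (intro inv) (simp add: mset_x)
      then have "replicate k 1 @ (replicate (i - k) 1 @ w # replicate j 1) \<in> parking_assortments y"
        by (rule parking_assortments_replace_suffix[where w = w])
          (use pos rest w1 False ij len_y in auto)
      also have "replicate k 1 @ (replicate (i - k) 1 @ w # replicate j 1) = z"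
        using False z by (simp flip: append_assoc replicate_add)
      finally show ?thesis .
    qed
  qed
  then have "replicate (length y - 1) 1 @ [w] \<in> invariant_parking_assortments y"
    by (auto simp: invariant_parking_assortments_def)
  then show ?thesis
    using w1 by blast
qed

theorem theorem4p5:
  fixes n :: nat and y :: "nat list"
  assumes "n \<ge> 1" and "length y = n" and "\<forall>i<n. y ! i \<ge> 1"
  shows "minimally_invariant y \<longleftrightarrow>
    \<not> (\<exists>w::nat. w > 1 \<and> replicate (n - 1) 1 @ [w] \<in> invariant_parking_assortments y)"
proof -
  have pos: "\<forall>l\<in>set y. 1 \<le> l"
    using assms by (auto simp: in_set_conv_nth)
  have ne: "replicate (n - 1) 1 @ [w] \<noteq> replicate n 1" if "w > 1" for w :: nat
    using that by (metis in_set_conv_decomp in_set_replicate less_irrefl)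
  have "replicate n 1 \<in> invariant_parking_assortments y"
    using replicate_1_invariant[OF _ pos] assms(1,2) by fastforce
  then show ?thesis
    using replace_by_1_invariant[OF _ pos] ne assms(2) unfolding minimally_invariant_def by blast
qed

end
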